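(* Context-free languages of arrows are closed under pullback along non-deterministic finite state automata, and under intersection with regular languages. That is, let $\mathcal{C}$ be a finitely generated category, $L\subseteq\mathcal{C}(A,B)$ a context-free language of arrows, and $M=(\mathcal{C},\mathcal{Q},p_M,q_0,q_f)$ a non-deterministic finite state automaton over $\mathcal{C}$ with $p_M(q_0)=A$ and $p_M(q_f)=B$. Then $p_M^{-1}(L)\cap\mathcal{Q}(q_0,q_f)$ is a context-free language of arrows of $\mathcal{Q}$, and $L\cap L_M$ is a context-free language of arrows of $\mathcal{C}$.
   Context: "Operad" means colored non-symmetric operad (multicategory); a functor of operads preserves types, identities and composition. A constant is an operation of arity $0$; $\alpha:S$ means $\alpha$ is a constant with output color $S$. Composition of arrows in categories is written in diagrammatic order. A category is finitely generated if it has finitely many objects and its arrows are generated under composition by finitely many arrows. A species consists of a set of colors and a set of nodes, each node $x:R_1,\dots,R_n\to R$ having a list of input colors and an output color; it is finite if both sets are finite. $\mathsf{Free}\,\mathcal{S}$ is the free operad on $\mathcal{S}$. The operad $\mathcal{W}[\mathcal{C}]$ of spliced arrows has as colors the pairs $(A,B)$ of objects of $\mathcal{C}$; an $n$-ary operation $(A_1,B_1),\dots,(A_n,B_n)\to(A,B)$ is a sequence $w_0{-}\cdots{-}w_n$ of arrows $w_i:B_i\to A_{i+1}$ ($0\le i\le n$, with $B_0=A$, $A_{n+1}=B$). Composition substitutes spliced arrows for the gaps "$-$", interpreting juxtaposition as composition in $\mathcal{C}$; the identity on $(A,B)$ is $\mathrm{id}_A{-}\mathrm{id}_B$. Constants of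 color $(A,B)$ are exactly arrows $A\to B$. A context-free grammar of arrows $G=(\mathcal{C},\mathcal{S},S,p)$ consists of a finitely generated category $\mathcal{C}$, a finite species $\mathcal{S}$, a color $S$, and a functor of operads $p:\mathsf{Free}\,\mathcal{S}\to\mathcal{W}[\mathcal{C}]$. Its language is $L_G=\{p(\alpha)\mid\alpha:S\}\subseteq\mathcal{C}(A,B)$ where $p(S)=(A,B)$. A subset of $\mathcal{C}(A,B)$ is a context-free language of arrows if it equals $L_G$ for some such $G$ with $p(S)=(A,B)$. A functor $p:\mathcal{Q}\to\mathcal{C}$ is ULF if for every arrow $\alpha$ of $\mathcal{Q}$ with $p(\alpha)=uv$ there is a unique pair $(\beta,\gamma)$ with $\alpha=\beta\gamma$, $p(\beta)=u$, $p(\gamma)=v$; it is finitary if fibers of objects and of arrows are finite. A non-deterministic finite state automaton over $\mathcal{C}$ is $M=(\mathcal{C},\mathcal{Q},p_M,q_0,q_f)$ with $p_M:\mathcal{Q}\to\mathcal{C}$ finitary ULF and $q_0,q_f$ objects of $\mathcal{Q}$; the regular language it recognizes is $L_M=\{p_M(\alpha)\mid\alpha:q_0\to q_f\}$. *)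

theory Defs
  imports Main
begin

section \<open>Categories and functors\<close>

record ('o, 'a) cat =
  obj :: "'o set"
  arr :: "'a set"
  src :: "'a \<Rightarrow> 'o"
  tgt :: "'a \<Rightarrow> 'o"
  ident :: "'o \<Rightarrow> 'a"
  cmp :: "'a \<Rightarrow> 'a \<Rightarrow> 'a"  (* diagrammatic order: cmp C f g is "first f, then g" *)

definition hom :: "('o, 'a) cat \<Rightarrow> 'o \<Rightarrow> 'o \<Rightarrow> 'a set" where
  "hom C A B = {f \<in> arr C. src C f = A \<and> tgt C f = B}"

locale category =
  fixes C :: "('o, 'a) cat"
  assumes src_obj: "f \<in> arr C \<Longrightarrow> src C f \<in> obj C"
    and tgt_obj: "f \<in> arr C \<Longrightarrow> tgt C f \<in> obj C"
    and ident_hom: "A \<in> obj C \<Longrightarrow> ident C A \<in> hom C A A"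
    and cmp_hom: "\<lbrakk>f \<in> arr C; g \<in> arr C; tgt C f = src C g\<rbrakk>
      \<Longrightarrow> cmp C f g \<in> hom C (src C f) (tgt C g)"
    and ident_cmp: "f \<in> arr C \<Longrightarrow> cmp C (ident C (src C f)) f = f"
    and cmp_ident: "f \<in> arr C \<Longrightarrow> cmp C f (ident C (tgt C f)) = f"
    and cmp_assoc: "\<lbrakk>f \<in> arr C; g \<in> arr C; h \<in> arr C; tgt C f = src C g; tgt C g = src C h\<rbrakk>
      \<Longrightarrow> cmp C (cmp C f g) h = cmp C f (cmp C g h)"

(* Identities are included as the empty composites. *)
inductive_set generated :: "('o, 'a) cat \<Rightarrow> 'a set \<Rightarrow> 'a set"
  for C :: "('o, 'a) cat" and E :: "'a set" where
  ident: "A \<in> obj C \<Longrightarrow> ident C A \<in> generated C E"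
| base: "e \<in> E \<Longrightarrow> e \<in> generated C E"
| cmp: "\<lbrakk>f \<in> generated C E; g \<in> generated C E; tgt C f = src C g\<rbrakk>
    \<Longrightarrow> cmp C f g \<in> generated C E"

definition finitely_generated :: "('o, 'a) cat \<Rightarrow> bool" where
  "finitely_generated C \<longleftrightarrow>
     finite (obj C) \<and> (\<exists>E. finite E \<and> E \<subseteq> arr C \<and> generated C E = arr C)"

locale cat_functor = dom: category Q + cod: category C
  for Q :: "('q, 'b) cat" and C :: "('o, 'a) cat" +
  fixes Fo :: "'q \<Rightarrow> 'o" and Fa :: "'b \<Rightarrow> 'a"
  assumes map_obj: "q \<in> obj Q \<Longrightarrow> Fo q \<in> obj C"
    and map_hom: "f \<in> arr Q \<Longrightarrow> Fa f \<in> hom C (Fo (src Q f)) (Fo (tgt Q f))"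
    and map_ident: "q \<in> obj Q \<Longrightarrow> Fa (ident Q q) = ident C (Fo q)"
    and map_cmp: "\<lbrakk>f \<in> arr Q; g \<in> arr Q; tgt Q f = src Q g\<rbrakk>
      \<Longrightarrow> Fa (cmp Q f g) = cmp C (Fa f) (Fa g)"

locale ulf_functor = cat_functor +
  assumes unique_factorization_lifting:
    "\<lbrakk>\<alpha> \<in> arr Q; u \<in> arr C; v \<in> arr C; tgt C u = src C v; Fa \<alpha> = cmp C u v\<rbrakk>
      \<Longrightarrow> \<exists>!(\<beta>, \<gamma>). \<beta> \<in> arr Q \<and> \<gamma> \<in> arr Q \<and> tgt Q \<beta> = src Q \<gamma>
            \<and> \<alpha> = cmp Q \<beta> \<gamma> \<and> Fa \<beta> = u \<and> Fa \<gamma> = v"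

locale finitary_functor = cat_functor +
  assumes finite_obj_fiber: "A \<in> obj C \<Longrightarrow> finite {q \<in> obj Q. Fo q = A}"
    and finite_arr_fiber: "w \<in> arr C \<Longrightarrow> finite {\<alpha> \<in> arr Q. Fa \<alpha> = w}"


section \<open>Colored non-symmetric operads\<close>

record ('c, 'f) operad =
  colors :: "'c set"
  ops :: "'f set"
  ins :: "'f \<Rightarrow> 'c list"
  out :: "'f \<Rightarrow> 'c"
  one :: "'c \<Rightarrow> 'f"
  plug :: "'f \<Rightarrow> 'f list \<Rightarrow> 'f"  (* plug P f [g1, ..., gn] plugs gi into the i-th input of f *)

definition composable :: "('c, 'f) operad \<Rightarrow> 'f \<Rightarrow> 'f list \<Rightarrow> bool" where
  "composable P f gs \<longleftrightarrow> f \<in> ops P \<and> set gs \<subseteq> ops P \<and> map (out P) gs = ins P f"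

locale operad =
  fixes P :: "('c, 'f) operad"
  assumes ins_colors: "f \<in> ops P \<Longrightarrow> set (ins P f) \<subseteq> colors P"
    and out_color: "f \<in> ops P \<Longrightarrow> out P f \<in> colors P"
    and one_op: "c \<in> colors P \<Longrightarrow> one P c \<in> ops P"
    and one_ins: "c \<in> colors P \<Longrightarrow> ins P (one P c) = [c]"
    and one_out: "c \<in> colors P \<Longrightarrow> out P (one P c) = c"
    and plug_op: "composable P f gs \<Longrightarrow> plug P f gs \<in> ops P"
    and plug_ins: "composable P f gs \<Longrightarrow> ins P (plug P f gs) = concat (map (ins P) gs)"
    and plug_out: "composable P f gs \<Longrightarrow> out P (plug P f gs) = out P f"
    and one_plug: "f \<in> ops P \<Longrightarrow> plug P (one P (out P f)) [f] = f"
    and plug_one: "f \<in> ops P \<Longrightarrow> plug P f (map (one P) (ins P f)) = f"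
    and plug_assoc: "\<lbrakk>composable P f gs; list_all2 (composable P) gs hss\<rbrakk>
      \<Longrightarrow> plug P (plug P f gs) (concat hss) = plug P f (map2 (plug P) gs hss)"

definition constants :: "('c, 'f) operad \<Rightarrow> 'c \<Rightarrow> 'f set" where
  "constants P c = {f \<in> ops P. ins P f = [] \<and> out P f = c}"

locale operad_functor = dom: operad O1 + cod: operad O2
  for O1 :: "('c, 'f) operad" and O2 :: "('d, 'g) operad" +
  fixes pc :: "'c \<Rightarrow> 'd" and po :: "'f \<Rightarrow> 'g"
  assumes map_color: "c \<in> colors O1 \<Longrightarrow> pc c \<in> colors O2"
    and map_op: "f \<in> ops O1 \<Longrightarrow> po f \<in> ops O2"
    and map_ins: "f \<in> ops O1 \<Longrightarrow> ins O2 (po f) = map pc (ins O1 f)"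
    and map_out: "f \<in> ops O1 \<Longrightarrow> out O2 (po f) = pc (out O1 f)"
    and map_one: "c \<in> colors O1 \<Longrightarrow> po (one O1 c) = one O2 (pc c)"
    and map_plug: "composable O1 f gs \<Longrightarrow> po (plug O1 f gs) = plug O2 (po f) (map po gs)"


section \<open>Species and free operads\<close>

record ('c, 'n) species =
  scolors :: "'c set"
  nodes :: "'n set"
  sins :: "'n \<Rightarrow> 'c list"
  sout :: "'n \<Rightarrow> 'c"

locale finite_species =
  fixes S :: "('c, 'n) species"
  assumes finite_scolors: "finite (scolors S)"
    and finite_nodes: "finite (nodes S)"
    and sins_scolors: "x \<in> nodes S \<Longrightarrow> set (sins S x) \<subseteq> scolors S"
    and sout_scolor: "x \<in> nodes S \<Longrightarrow> sout S x \<in> scolors S"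

(* Leaf c is the identity operation on the color c, so the leaves of a tree are its inputs;
   a nullary node is a Node with no subtrees and contributes no leaf. *)
datatype ('c, 'n) tree = Leaf 'c | Node 'n "('c, 'n) tree list"

primrec leaves :: "('c, 'n) tree \<Rightarrow> 'c list" where
  "leaves (Leaf c) = [c]"
| "leaves (Node x ts) = concat (map leaves ts)"

primrec root :: "('c, 'n) species \<Rightarrow> ('c, 'n) tree \<Rightarrow> 'c" where
  "root S (Leaf c) = c"
| "root S (Node x ts) = sout S x"

inductive_set trees :: "('c, 'n) species \<Rightarrow> ('c, 'n) tree set"
  for S :: "('c, 'n) species" where
  Leaf: "c \<in> scolors S \<Longrightarrow> Leaf c \<in> trees S"
| Node: "\<lbrakk>x \<in> nodes S; \<forall>t \<in> set ts. t \<in> trees S; map (root S) ts = sins S x\<rbrakk>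
    \<Longrightarrow> Node x ts \<in> trees S"

(* Grafts the trees of the list onto the leaves, from left to right. *)
fun graft :: "('c, 'n) tree \<Rightarrow> ('c, 'n) tree list \<Rightarrow> ('c, 'n) tree"
  and grafts :: "('c, 'n) tree list \<Rightarrow> ('c, 'n) tree list \<Rightarrow> ('c, 'n) tree list" where
  "graft (Leaf c) us = hd us"
| "graft (Node x ts) us = Node x (grafts ts us)"
| "grafts [] us = []"
| "grafts (t # ts) us =
     graft t (take (length (leaves t)) us) # grafts ts (drop (length (leaves t)) us)"

definition free_operad :: "('c, 'n) species \<Rightarrow> ('c, ('c, 'n) tree) operad" where
  "free_operad S = \<lparr>colors = scolors S, ops = trees S, ins = leaves, out = root S,
     one = Leaf, plug = graft\<rparr>"


section \<open>The operad of spliced arrows\<close>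

(* glue C [v0, ..., vm] [w0, ..., wn] = [v0, ..., vm w0, ..., wn] *)
definition glue :: "('o, 'a) cat \<Rightarrow> 'a list \<Rightarrow> 'a list \<Rightarrow> 'a list" where
  "glue C vs ws = butlast vs @ cmp C (last vs) (hd ws) # tl ws"

fun splice :: "('o, 'a) cat \<Rightarrow> 'a list \<Rightarrow> 'a list list \<Rightarrow> 'a list" where
  "splice C (w # ws) (u # us) = glue C (glue C [w] u) (splice C ws us)"
| "splice C ws us = ws"

(* The operation w0 - ... - wn is the list [w0, ..., wn]. Its type can be read off from the arrows:
   the i-th gap sits between w_(i-1) and w_i, so its color is (tgt w_(i-1), src w_i), and the
   output color is (src w0, tgt wn). *)
definition spliced_arrows :: "('o, 'a) cat \<Rightarrow> ('o \<times> 'o, 'a list) operad" where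
  "spliced_arrows C = \<lparr>
     colors = obj C \<times> obj C,
     ops = {ws. ws \<noteq> [] \<and> set ws \<subseteq> arr C},
     ins = (\<lambda>ws. zip (map (tgt C) (butlast ws)) (map (src C) (tl ws))),
     out = (\<lambda>ws. (src C (hd ws), tgt C (last ws))),
     one = (\<lambda>(A, B). [ident C A, ident C B]),
     plug = splice C\<rparr>"


section \<open>Context-free grammars and languages of arrows\<close>

record ('o, 'a, 'c, 'n) grammar =
  gcat :: "('o, 'a) cat"
  gspecies :: "('c, 'n) species"
  start :: 'c
  gcol :: "'c \<Rightarrow> 'o \<times> 'o"
  gop :: "('c, 'n) tree \<Rightarrow> 'a list"

definition context_free_grammar :: "('o, 'a, 'c, 'n) grammar \<Rightarrow> bool" where
  "context_free_grammar G \<longleftrightarrow>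
     category (gcat G) \<and> finitely_generated (gcat G) \<and>
     finite_species (gspecies G) \<and> start G \<in> scolors (gspecies G) \<and>
     operad_functor (free_operad (gspecies G)) (spliced_arrows (gcat G)) (gcol G) (gop G)"

(* Constants of spliced_arrows C are the one-element lists, identified with arrows of C. *)
definition language :: "('o, 'a, 'c, 'n) grammar \<Rightarrow> 'a set" where
  "language G = {w. \<exists>\<alpha> \<in> constants (free_operad (gspecies G)) (start G). gop G \<alpha> = [w]}"

(* The colors and nodes of the grammar are taken to be natural numbers, since one cannot quantify
   over types; by context_free_language_language below this is no loss of generality. *)
definition context_free_language :: "('o, 'a) cat \<Rightarrow> 'o \<Rightarrow> 'o \<Rightarrow> 'a set \<Rightarrow> bool" where
  "context_free_language C A B L \<longleftrightarrow>
     (\<exists>G :: ('o, 'a, nat, nat) grammar. context_free_grammar G \<and> gcat G = C \<and>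
        gcol G (start G) = (A, B) \<and> language G = L)"


section \<open>Finite state automata over a category\<close>

record ('o, 'a, 'q, 'b) automaton =
  base :: "('o, 'a) cat"
  states :: "('q, 'b) cat"
  aobj :: "'q \<Rightarrow> 'o"
  aarr :: "'b \<Rightarrow> 'a"
  initial :: 'q
  final :: 'q

definition nfa :: "('o, 'a, 'q, 'b) automaton \<Rightarrow> bool" where
  "nfa M \<longleftrightarrow>
     ulf_functor (states M) (base M) (aobj M) (aarr M) \<and>
     finitary_functor (states M) (base M) (aobj M) (aarr M) \<and>
     initial M \<in> obj (states M) \<and> final M \<in> obj (states M)"

definition recognized :: "('o, 'a, 'q, 'b) automaton \<Rightarrow> 'a set" where
  "recognized M = aarr M ` hom (states M) (initial M) (final M)"

section \<open>The free operad is an operad\<close>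

lemma grafts_concat:
  "list_all2 (\<lambda>t us. length us = length (leaves t)) ts uss
    \<Longrightarrow> grafts ts (concat uss) = map2 graft ts uss"
  by (induction ts uss rule: list_all2_induct) auto

lemma list_split_leaves:
  assumes "map f us = concat (map leaves ts)"
  obtains uss where "us = concat uss" and "list_all2 (\<lambda>t us. map f us = leaves t) ts uss"
  using assms
proof (induction ts arbitrary: us thesis)
  case Nil
  then show ?case by (metis concat.simps(1) list.rel_inject(1) list.simps(8) map_is_Nil_conv)
next
  case (Cons t ts)
  from Cons.prems(2) obtain us1 us2 where us: "us = us1 @ us2" "map f us1 = leaves t"
      "map f us2 = concat (map leaves ts)"
    by (auto simp: map_eq_append_conv)
  from Cons.IH[OF _ us(3)] obtain uss where "us2 = concat uss"
      "list_all2 (\<lambda>t us. map f us = leaves t) ts uss" by blast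
  then show ?case using us Cons.prems(1)[of "us1 # uss"] by auto
qed

lemma leaves_graft: "length us = length (leaves t) \<Longrightarrow> leaves (graft t us) = concat (map leaves us)"
proof (induction t arbitrary: us)
  case (Leaf c)
  then obtain u where "us = [u]" by (cases us) auto
  then show ?case by simp
next
  case (Node x ts)
  have "map (\<lambda>_. ()) us = map (\<lambda>_. ()) (concat (map leaves ts))"
    using Node.prems by (auto simp: map_replicate_const)
  then have "\<exists>uss. us = concat uss \<and> list_all2 (\<lambda>t us. length us = length (leaves t)) ts uss"
    (is "\<exists>uss. ?P us ts uss")
  proof (induction ts arbitrary: us)
    case Nil then show ?case by auto
  next
    case (Cons t ts)
    then obtain us1 us2 where us: "us = us1 @ us2" "map (\<lambda>_. ()) us1 = map (\<lambda>_. ()) (leaves t)"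
      "map (\<lambda>_. ()) us2 = map (\<lambda>_. ()) (concat (map leaves ts))"
      by (auto simp: map_eq_append_conv)
    from Cons.IH[OF us(3)] obtain uss where "us2 = concat uss"
      "list_all2 (\<lambda>t us. length us = length (leaves t)) ts uss" by blast
    then show ?case using us map_eq_imp_length_eq[OF us(2)] by (intro exI[of _ "us1 # uss"]) auto
  qed
  then obtain uss where uss: "us = concat uss" 
    "list_all2 (\<lambda>t us. length us = length (leaves t)) ts uss" by blast
  from uss(2) Node.IH have "concat (map leaves (map2 graft ts uss)) = concat (map leaves (concat uss))"
    by (induction ts uss rule: list_all2_induct) auto
  then show ?case using uss grafts_concat[OF uss(2)] by simp
qed

lemma root_graft:
  "map (root S) us = leaves t \<Longrightarrow> root S (graft t us) = root S t"
  by (cases t; cases us) auto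

lemma graft_trees:
  assumes "t \<in> trees S" "map (root S) us = leaves t" "set us \<subseteq> trees S"
  shows "graft t us \<in> trees S"
  using assms
proof (induction t arbitrary: us rule: tree.induct)
  case (Leaf c)
  then show ?case by (cases us) auto
next
  case (Node x ts)
  have "map (root S) us = concat (map leaves ts)"
    using Node by simp
  then obtain uss where uss: "us = concat uss"
      "list_all2 (\<lambda>t us. map (root S) us = leaves t) ts uss"
    by (rule list_split_leaves)
  have len: "list_all2 (\<lambda>t us. length us = length (leaves t)) ts uss"
    by (rule list_all2_mono[OF uss(2)]) (metis length_map)
  from Node.prems(1) have x: "x \<in> nodes S" "\<forall>t\<in>set ts. t \<in> trees S" "map (root S) ts = sins S x"
    by (auto elim: trees.cases)
  have "set us \<subseteq> trees S" by fact
  with uss(2) Node.IH x(2) have "(\<forall>t\<in>set (map2 graft ts uss). t \<in> trees S) \<and>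
      map (root S) (map2 graft ts uss) = map (root S) ts"
    unfolding uss(1) by (induction ts uss rule: list_all2_induct) (auto simp: root_graft)
  then show ?case using x grafts_concat[OF len] uss(1) by (auto intro!: trees.Node)
qed

lemma graft_leaves: "graft t (map Leaf (leaves t)) = t"
proof (induction t)
  case (Node x ts)
  then have "grafts ts (map Leaf (concat (map leaves ts))) = ts"
    by (induction ts) auto
  then show ?case by simp
qed simp

lemma graft_graft:
  assumes "map (root S) us = leaves t" "list_all2 (\<lambda>u vs. map (root S) vs = leaves u) us vss"
  shows "graft (graft t us) (concat vss) = graft t (map2 graft us vss)"
  using assms
proof (induction t arbitrary: us vss)
  case (Leaf c)
  then obtain u where u: "us = [u]" by (cases us) auto
  with Leaf obtain vs where "vss = [vs]" by (auto simp: list_all2_Cons1)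
  with u show ?case by simp
next
  case (Node x ts)
  from Node.prems(1) obtain uss where uss: "us = concat uss"
      "list_all2 (\<lambda>t us. map (root S) us = leaves t) ts uss"
    by (auto elim: list_split_leaves)
  have "grafts (grafts ts us) (concat vss) = grafts ts (map2 graft us vss)"
    using uss(2) Node.IH Node.prems(2) unfolding uss(1)
  proof (induction ts uss arbitrary: vss rule: list_all2_induct)
    case Nil then show ?case by simp
  next
    case (Cons t ts us uss)
    from Cons.prems(2) obtain vss1 vss2 where v: "vss = vss1 @ vss2"
      "list_all2 (\<lambda>u vs. map (root S) vs = leaves u) us vss1"
      "list_all2 (\<lambda>u vs. map (root S) vs = leaves u) (concat uss) vss2"
      by (auto simp: list_all2_append1)
    have l: "length us = length vss1" using v(2) by (rule list_all2_lengthD)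
    have lt: "length us = length (leaves t)" using Cons.hyps by (metis length_map)
    from v(2) have "length (concat vss1) = length (concat (map leaves us))"
      by (induction us vss1 rule: list_all2_induct) (auto, metis length_map)
    then have lc: "length (concat vss1) = length (leaves (graft t us))"
      using leaves_graft[OF lt] by simp
    have *: "graft (graft t us) (concat vss1) = graft t (map2 graft us vss1)"
      using Cons.prems(1)[of t us vss1] Cons.hyps v(2) by simp
    show ?case
      using lc lt l Cons.IH[OF _ v(3)] Cons.prems(1) * v(1)
      by simp
  qed
  then show ?case by simp
qed

lemma root_scolor: "finite_species S \<Longrightarrow> t \<in> trees S \<Longrightarrow> root S t \<in> scolors S"
  by (cases t) (auto elim: trees.cases simp: finite_species.sout_scolor)

lemma leaves_scolors: "t \<in> trees S \<Longrightarrow> set (leaves t) \<subseteq> scolors S"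
  by (induction t rule: trees.induct) auto

theorem operad_free_operad:
  assumes "finite_species S"
  shows "operad (free_operad S)"
proof (unfold_locales, goal_cases)
  case (1 f) then show ?case using leaves_scolors by (auto simp: free_operad_def)
next
  case (2 f) then show ?case using root_scolor[OF assms] by (auto simp: free_operad_def)
next
  case (6 f gs) then show ?case by (auto simp: free_operad_def composable_def intro: graft_trees)
next
  case (7 f gs) then show ?case
    by (auto simp: free_operad_def composable_def intro!: leaves_graft) (metis length_map)
next
  case (8 f gs) then show ?case by (auto simp: free_operad_def composable_def root_graft)
next
  case (11 f gs hss) 
  have "list_all2 (\<lambda>u vs. map (root S) vs = leaves u) gs hss"
    by (rule list_all2_mono[OF 11(2)]) (auto simp: free_operad_def composable_def)
  then show ?case using 11(1) by (auto simp: free_operad_def composable_def intro: graft_graft)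
qed (auto simp: free_operad_def graft_leaves intro: trees.Leaf)


section \<open>Spliced arrows form an operad\<close>

context category
begin

definition "arrs ws \<longleftrightarrow> ws \<noteq> [] \<and> set ws \<subseteq> arr C"

lemma arrs_Cons: "arrs (w # ws) \<longleftrightarrow> w \<in> arr C \<and> (ws = [] \<or> arrs ws)"
  by (auto simp: arrs_def)

lemma cmp_simps:
  assumes "f \<in> arr C" "g \<in> arr C" "tgt C f = src C g"
  shows "cmp C f g \<in> arr C" "src C (cmp C f g) = src C f" "tgt C (cmp C f g) = tgt C g"
  using cmp_hom[OF assms] by (auto simp: hom_def)

lemma ident_simps:
  assumes "A \<in> obj C"
  shows "ident C A \<in> arr C" "src C (ident C A) = A" "tgt C (ident C A) = A"
  using ident_hom[OF assms] by (auto simp: hom_def)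

definition "gaps ws = zip (map (tgt C) (butlast ws)) (map (src C) (tl ws))"

lemma gaps_simps: "gaps [w] = []" "gaps (w # w' # ws) = (tgt C w, src C w') # gaps (w' # ws)"
  by (auto simp: gaps_def)

lemma glue_simps: "glue C [v] (w # ws) = cmp C v w # ws"
  "glue C (v # v' # vs) ws = v # glue C (v' # vs) ws"
  by (auto simp: glue_def)

lemma arrs_induct [consumes 1, case_names single Cons]:
  assumes "arrs ws" "\<And>w. w \<in> arr C \<Longrightarrow> P [w]"
    "\<And>w w' ws. \<lbrakk>w \<in> arr C; arrs (w' # ws); P (w' # ws)\<rbrakk> \<Longrightarrow> P (w # w' # ws)"
  shows "P ws"
  using assms(1)
proof (induction ws rule: induct_list012)
  case (3 x y zs)
  then show ?case using assms(3)[of x y zs] by (auto simp: arrs_Cons)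
qed (auto simp: arrs_def assms)

lemma glue_typing:
  assumes "arrs vs" "arrs ws" "tgt C (last vs) = src C (hd ws)"
  shows "arrs (glue C vs ws) \<and> gaps (glue C vs ws) = gaps vs @ gaps ws \<and>
    src C (hd (glue C vs ws)) = src C (hd vs) \<and> tgt C (last (glue C vs ws)) = tgt C (last ws)"
  using assms(1,3)
proof (induction vs rule: arrs_induct)
  case (single w)
  obtain v vs where ws: "ws = v # vs" using assms(2) by (cases ws) (auto simp: arrs_def)
  have v: "v \<in> arr C" "w \<in> arr C" "tgt C w = src C v" using assms(2) single ws by (auto simp: arrs_def)
  show ?case using assms(2) unfolding ws
    by (cases vs) (auto simp: glue_simps gaps_simps arrs_Cons cmp_simps[OF v(2,1,3)])
next
  case (Cons w w' ws')
  then obtain x xs where "glue C (w' # ws') ws = x # xs"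
    by (cases "glue C (w' # ws') ws") (auto simp: arrs_def)
  then show ?case using Cons by (auto simp: glue_simps gaps_simps arrs_Cons)
qed

lemma glue_assoc:
  assumes "arrs us" "arrs vs" "arrs ws" "tgt C (last us) = src C (hd vs)" "tgt C (last vs) = src C (hd ws)"
  shows "glue C (glue C us vs) ws = glue C us (glue C vs ws)"
  using assms(1,4)
proof (induction us rule: arrs_induct)
  case (single u)
  obtain v vs' where vs: "vs = v # vs'" using assms(2) by (cases vs) (auto simp: arrs_def)
  obtain w ws' where ws: "ws = w # ws'" using assms(3) by (cases ws) (auto simp: arrs_def)
  show ?case
    using assms(2,3,5) single cmp_assoc[of u v w] unfolding vs ws
    by (cases vs') (auto simp: glue_simps arrs_Cons)
next
  case (Cons w w' us')
  then obtain x xs where "glue C (w' # us') vs = x # xs"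
    using glue_typing[of "w' # us'" vs] assms(2) by (cases "glue C (w' # us') vs") (auto simp: arrs_def)
  then show ?case using Cons by (auto simp: glue_simps)
qed

definition "fits f gs \<longleftrightarrow>
  (\<forall>g \<in> set gs. arrs g) \<and> map (\<lambda>g. (src C (hd g), tgt C (last g))) gs = gaps f"

lemma fits_simps:
  "fits [w] gs \<longleftrightarrow> gs = []"
  "fits (w # w' # ws) gs \<longleftrightarrow> (\<exists>u us. gs = u # us \<and> arrs u \<and> src C (hd u) = tgt C w \<and>
     tgt C (last u) = src C w' \<and> fits (w' # ws) us)"
  by (cases gs; auto simp: fits_def gaps_simps)+

lemma single_glue_typing:
  assumes "arrs u" "w \<in> arr C" "src C (hd u) = tgt C w"
  shows "arrs (glue C [w] u)" "gaps (glue C [w] u) = gaps u"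
    "src C (hd (glue C [w] u)) = src C w" "tgt C (last (glue C [w] u)) = tgt C (last u)"
  using glue_typing[of "[w]" u] assms by (auto simp: arrs_Cons gaps_simps)

lemma splice_typing:
  assumes "arrs f" "fits f gs"
  shows "arrs (splice C f gs) \<and> gaps (splice C f gs) = concat (map gaps gs) \<and>
    src C (hd (splice C f gs)) = src C (hd f) \<and> tgt C (last (splice C f gs)) = tgt C (last f)"
  using assms
proof (induction f arbitrary: gs rule: arrs_induct)
  case (single w)
  then show ?case by (auto simp: fits_simps gaps_simps arrs_Cons)
next
  case (Cons w w' f)
  then obtain u us where gs: "gs = u # us" "arrs u" "src C (hd u) = tgt C w"
    "tgt C (last u) = src C w'" "fits (w' # f) us" by (auto simp: fits_simps)
  note 1 = single_glue_typing[OF gs(2) Cons.hyps(1) gs(3)]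
  note 2 = Cons.IH[OF gs(5)]
  show ?case using glue_typing[of "glue C [w] u" "splice C (w' # f) us"] 1 2 gs by auto
qed

lemma splice_glue:
  assumes "arrs f" "arrs g" "tgt C (last f) = src C (hd g)" "fits f us" "fits g vs"
  shows "splice C (glue C f g) (us @ vs) = glue C (splice C f us) (splice C g vs)"
  using assms(1,3,4)
proof (induction f arbitrary: us rule: arrs_induct)
  case (single w)
  then have us: "us = []" by (simp add: fits_simps)
  obtain x g' where g: "g = x # g'" using assms(2) by (cases g) (auto simp: arrs_def)
  show ?case
  proof (cases g')
    case Nil
    then show ?thesis using g us assms(5) by (auto simp: fits_simps glue_simps)
  next
    case g': (Cons y g'')
    with assms(5) g obtain v vs' where vs: "vs = v # vs'" "arrs v" "src C (hd v) = tgt C x"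
      "tgt C (last v) = src C y" "fits (y # g'') vs'" by (auto simp: fits_simps)
    have x: "x \<in> arr C" "arrs (y # g'')" using assms(2) g g' by (auto simp: arrs_Cons)
    have wx: "tgt C w = src C x" using single g by simp
    note 1 = single_glue_typing[OF vs(2) x(1) vs(3)]
    note 2 = splice_typing[OF x(2) vs(5)]
    have "glue C [w] (glue C (glue C [x] v) (splice C (y # g'') vs'))
        = glue C (glue C [w] (glue C [x] v)) (splice C (y # g'') vs')"
      using 1 2 single wx vs(4) by (intro glue_assoc[symmetric]) (auto simp: arrs_Cons)
    also have "glue C [w] (glue C [x] v) = glue C (glue C [w] [x]) v"
      using single x wx vs by (intro glue_assoc[symmetric]) (auto simp: arrs_Cons)
    finally show ?thesis using g g' vs us by (simp add: glue_simps)
  qed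
next
  case (Cons w w' f)
  then obtain u us' where us: "us = u # us'" "arrs u" "src C (hd u) = tgt C w"
    "tgt C (last u) = src C w'" "fits (w' # f) us'" by (auto simp: fits_simps)
  note 1 = single_glue_typing[OF us(2) Cons.hyps(1) us(3)]
  note 2 = splice_typing[OF Cons.hyps(2) us(5)]
  note 3 = splice_typing[OF assms(2,5)]
  have "splice C (glue C (w # w' # f) g) (us @ vs)
      = glue C (glue C [w] u) (splice C (glue C (w' # f) g) (us' @ vs))"
    using us by (simp add: glue_simps)
  also have "\<dots> = glue C (glue C [w] u) (glue C (splice C (w' # f) us') (splice C g vs))"
    using Cons.IH[of us'] us Cons.prems by simp
  also have "\<dots> = glue C (splice C (w # w' # f) us) (splice C g vs)"
    using 1 2 3 us Cons.prems by (simp add: glue_assoc)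
  finally show ?case .
qed

lemma splice_splice:
  assumes "arrs f" "fits f gs" "list_all2 fits gs hss"
  shows "splice C (splice C f gs) (concat hss) = splice C f (map2 (splice C) gs hss)"
  using assms
proof (induction f arbitrary: gs hss rule: arrs_induct)
  case (single w)
  then show ?case by (auto simp: fits_simps)
next
  case (Cons w w' f)
  then obtain u us where gs: "gs = u # us" "arrs u" "src C (hd u) = tgt C w"
    "tgt C (last u) = src C w'" "fits (w' # f) us" by (auto simp: fits_simps)
  with Cons.prems(2) obtain hs hss' where hss: "hss = hs # hss'" "fits u hs" "list_all2 fits us hss'"
    by (auto simp: list_all2_Cons1)
  note 1 = single_glue_typing[OF gs(2) Cons.hyps(1) gs(3)]
  note 2 = splice_typing[OF Cons.hyps(2) gs(5)]
  have fR: "fits (splice C (w' # f) us) (concat hss')"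
  proof -
    have "(\<forall>g \<in> set (concat hss'). arrs g) \<and>
        map (\<lambda>g. (src C (hd g), tgt C (last g))) (concat hss') = concat (map gaps us)"
      using hss(3) by (induction us hss' rule: list_all2_induct) (auto simp: fits_def)
    then show ?thesis using 2 by (simp add: fits_def)
  qed
  have fu: "fits (glue C [w] u) hs" using hss(2) 1 by (simp add: fits_def)
  have "splice C (splice C (w # w' # f) gs) (concat hss)
     = splice C (glue C (glue C [w] u) (splice C (w' # f) us)) (hs @ concat hss')"
    using gs hss by simp
  also have "\<dots> = glue C (splice C (glue C [w] u) hs) (splice C (splice C (w' # f) us) (concat hss'))"
    using 1 2 fR fu gs by (intro splice_glue) auto
  also have "splice C (glue C [w] u) hs = glue C [w] (splice C u hs)"
    using splice_glue[of "[w]" u "[]" hs] Cons.hyps gs hss by (auto simp: arrs_Cons fits_simps)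
  also have "splice C (splice C (w' # f) us) (concat hss') = splice C (w' # f) (map2 (splice C) us hss')"
    using Cons.IH gs hss by simp
  finally show ?case using gs hss by simp
qed

lemma glue_ident: "arrs f \<Longrightarrow> glue C f [ident C (tgt C (last f))] = f"
  by (induction f rule: arrs_induct) (auto simp: glue_simps cmp_ident)

lemma ident_glue: "arrs f \<Longrightarrow> glue C [ident C (src C (hd f))] f = f"
  by (cases f) (auto simp: glue_simps ident_cmp arrs_def)

lemma splice_ident:
  "arrs f \<Longrightarrow> splice C f (map (\<lambda>(A, B). [ident C A, ident C B]) (gaps f)) = f"
  by (induction f rule: arrs_induct) (auto simp: glue_simps gaps_simps cmp_ident ident_cmp arrs_Cons)

lemma composable_spliced_arrows: "composable (spliced_arrows C) f gs \<longleftrightarrow> arrs f \<and> fits f gs"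
  by (auto simp: composable_def spliced_arrows_def arrs_def fits_def gaps_def)

theorem operad_spliced_arrows: "operad (spliced_arrows C)"
proof (unfold_locales, goal_cases)
  case (1 f)
  then have f: "set (butlast f) \<subseteq> arr C" "set (tl f) \<subseteq> arr C"
    by (auto simp: spliced_arrows_def dest: in_set_butlastD list.set_sel(2))
  show ?case
  proof
    fix c assume "c \<in> set (ins (spliced_arrows C) f)"
    then obtain A B where c: "c = (A, B)"
      and AB: "(A, B) \<in> set (zip (map (tgt C) (butlast f)) (map (src C) (tl f)))"
      by (cases c rule: prod.exhaust) (simp add: spliced_arrows_def)
    from f set_zip_leftD[OF AB] set_zip_rightD[OF AB] have "A \<in> obj C" "B \<in> obj C"
      by (auto intro: src_obj tgt_obj)
    then show "c \<in> colors (spliced_arrows C)"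
      by (simp add: c spliced_arrows_def)
  qed
next
  case (2 f) then show ?case by (auto simp: spliced_arrows_def intro!: src_obj tgt_obj)
next
  case (6 f gs) then show ?case
    using splice_typing[of f gs] unfolding composable_spliced_arrows
    by (auto simp: spliced_arrows_def arrs_def)
next
  case (7 f gs) then show ?case
    using splice_typing[of f gs] unfolding composable_spliced_arrows
    by (auto simp: spliced_arrows_def gaps_def[abs_def])
next
  case (8 f gs) then show ?case
    using splice_typing[of f gs] unfolding composable_spliced_arrows
    by (auto simp: spliced_arrows_def)
next
  case (9 f)
  then have "arrs f" by (auto simp: spliced_arrows_def arrs_def)
  then show ?case by (auto simp: spliced_arrows_def ident_glue glue_ident)
next
  case (10 f)
  then have "arrs f" by (auto simp: spliced_arrows_def arrs_def)
  from splice_ident[OF this] show ?case by (simp add: spliced_arrows_def gaps_def)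
next
  case (11 f gs hss)
  have "list_all2 fits gs hss"
    by (rule list_all2_mono[OF 11(2)]) (simp add: composable_spliced_arrows)
  with 11(1) show ?case
    unfolding composable_spliced_arrows by (simp add: splice_splice spliced_arrows_def)
qed (auto simp: spliced_arrows_def ident_simps)

end


section \<open>Grammars with arbitrary colors and nodes\<close>

lemma leaves_map_tree: "leaves (map_tree f g t) = map f (leaves t)"
  by (induction t) (auto simp: map_concat intro!: arg_cong[of _ _ concat])

lemma map_tree_graft:
  "length us = length (leaves t) \<Longrightarrow>
    map_tree f g (graft t us) = graft (map_tree f g t) (map (map_tree f g) us)"
  "length us = length (concat (map leaves ts)) \<Longrightarrow>
    map (map_tree f g) (grafts ts us) = grafts (map (map_tree f g) ts) (map (map_tree f g) us)"
proof (induction t us and ts us rule: graft_grafts.induct)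
  case (1 c us) then show ?case by (cases us) auto
qed (auto simp: leaves_map_tree take_map drop_map)

lemma trees_map_tree:
  assumes "t \<in> trees S"
    and "\<And>c. c \<in> scolors S \<Longrightarrow> f c \<in> scolors S'"
    and "\<And>x. x \<in> nodes S \<Longrightarrow> g x \<in> nodes S' \<and> sins S' (g x) = map f (sins S x) \<and> sout S' (g x) = f (sout S x)"
  shows "map_tree f g t \<in> trees S' \<and> root S' (map_tree f g t) = f (root S t)"
  using assms(1)
proof (induction t rule: trees.induct)
  case (Node x ts)
  then have "map (root S') (map (map_tree f g) ts) = map (f \<circ> root S) ts" by auto
  also have "\<dots> = map f (sins S x)" using Node(2)[symmetric] by simp
  finally have "map (root S') (map (map_tree f g) ts) = map f (sins S x)" .
  then show ?case using Node assms(3)[of x] by (auto simp del: map_map intro!: trees.Node)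
qed (auto intro: trees.Leaf assms)

lemma map_tree_inverse:
  assumes "t \<in> trees S" "\<And>c. c \<in> scolors S \<Longrightarrow> f' (f c) = c" "\<And>x. x \<in> nodes S \<Longrightarrow> g' (g x) = x"
  shows "map_tree f' g' (map_tree f g t) = t"
  using assms(1) by (induction t rule: trees.induct) (auto simp: assms map_idI)

theorem context_free_language_language:
  fixes G :: "('o, 'a, 'c, 'n) grammar"
  assumes G: "context_free_grammar G" and AB: "gcol G (start G) = (A, B)"
  shows "context_free_language (gcat G) A B (language G)"
proof -
  define S where "S = gspecies G"
  interpret S: finite_species S using G by (simp add: S_def context_free_grammar_def)
  interpret p: operad_functor "free_operad S" "spliced_arrows (gcat G)" "gcol G" "gop G"
    using G by (simp add: S_def context_free_grammar_def)
  obtain ec :: "'c \<Rightarrow> nat" where "inj_on ec (scolors S)"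
    using finite_imp_inj_to_nat_seg[OF S.finite_scolors] by blast
  then obtain dc where dc: "\<And>c. c \<in> scolors S \<Longrightarrow> dc (ec c) = c"
    using inv_into_f_f by metis
  obtain en :: "'n \<Rightarrow> nat" where "inj_on en (nodes S)"
    using finite_imp_inj_to_nat_seg[OF S.finite_nodes] by blast
  then obtain dn where dn: "\<And>x. x \<in> nodes S \<Longrightarrow> dn (en x) = x"
    using inv_into_f_f by metis
  define S' where "S' = \<lparr>scolors = ec ` scolors S, nodes = en ` nodes S,
    sins = (\<lambda>x. map ec (sins S (dn x))), sout = (\<lambda>x. ec (sout S (dn x)))\<rparr>"
  define G' where "G' = \<lparr>gcat = gcat G, gspecies = S', start = ec (start G),
    gcol = gcol G \<circ> dc, gop = gop G \<circ> map_tree dc dn\<rparr>"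
  have S': "finite_species S'"
    using S.finite_scolors S.finite_nodes S.sins_scolors S.sout_scolor
    by unfold_locales (auto simp: S'_def dn, blast)
  have dc_ec: "map (dc \<circ> ec) (sins S x) = sins S x" if "x \<in> nodes S" for x
    using S.sins_scolors[OF that] dc by (intro map_idI) auto
  have bwd: "map_tree dc dn t \<in> trees S \<and> root S (map_tree dc dn t) = dc (root S' t)"
    if "t \<in> trees S'" for t
    using that by (rule trees_map_tree)
      (use S.sout_scolor in \<open>auto simp: S'_def dc dn dc_ec\<close>)
  have fwd: "map_tree ec en t \<in> trees S' \<and> root S' (map_tree ec en t) = ec (root S t)"
    if "t \<in> trees S" for t
    using that by (rule trees_map_tree) (auto simp: S'_def dn)
  have inv: "map_tree dc dn (map_tree ec en t) = t" if "t \<in> trees S" for t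
    using that by (rule map_tree_inverse) (auto simp: dc dn)
  interpret S': operad "free_operad S'" using S' by (rule operad_free_operad)
  have p': "operad_functor (free_operad S') (spliced_arrows (gcat G)) (gcol G \<circ> dc) (gop G \<circ> map_tree dc dn)"
  proof (unfold_locales, goal_cases)
    case (1 c)
    then show ?case using p.map_color by (auto simp: free_operad_def S'_def dc)
  next
    case (2 t)
    then show ?case using p.map_op bwd by (auto simp: free_operad_def)
  next
    case (3 t)
    then show ?case using p.map_ins bwd by (auto simp: free_operad_def leaves_map_tree)
  next
    case (4 t)
    then show ?case using p.map_out bwd by (auto simp: free_operad_def)
  next
    case (5 c)
    then show ?case using p.map_one[of "dc c"] by (auto simp: free_operad_def S'_def dc)
  next
    case (6 t us)
    then have t: "t \<in> trees S'" "set us \<subseteq> trees S'" "map (root S') us = leaves t"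
      by (auto simp: composable_def free_operad_def)
    have "map (root S) (map (map_tree dc dn) us) = map dc (map (root S') us)"
      using t(2) bwd by auto
    then have "composable (free_operad S) (map_tree dc dn t) (map (map_tree dc dn) us)"
      using t bwd by (auto simp: composable_def free_operad_def leaves_map_tree)
    from p.map_plug[OF this] show ?case
      using map_tree_graft(1)[of us t dc dn] arg_cong[OF t(3), of length]
      by (simp add: free_operad_def)
  qed
  have "context_free_grammar G'"
    using G S' p' by (auto simp: context_free_grammar_def G'_def S'_def[THEN arg_cong[of _ _ scolors]] S_def)
  moreover have "gcol G' (start G') = (A, B)"
    using AB G by (auto simp: G'_def dc S_def context_free_grammar_def)
  moreover have "language G' = language G"
  proof -
    have st: "dc (ec (start G)) = start G"
      using G by (auto simp: dc S_def context_free_grammar_def)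
    have "\<exists>\<beta>\<in>constants (free_operad S') (ec (start G)). map_tree dc dn \<beta> = \<alpha>"
      if "\<alpha> \<in> constants (free_operad S) (start G)" for \<alpha>
      using that fwd inv by (intro bexI[of _ "map_tree ec en \<alpha>"])
        (auto simp: constants_def free_operad_def leaves_map_tree)
    moreover have "map_tree dc dn \<beta> \<in> constants (free_operad S) (start G)"
      if "\<beta> \<in> constants (free_operad S') (ec (start G))" for \<beta>
      using that bwd st by (auto simp: constants_def free_operad_def leaves_map_tree)
    ultimately show ?thesis
      by (fastforce simp: language_def G'_def S_def[symmetric])
  qed
  ultimately show ?thesis
    unfolding context_free_language_def by (intro exI[of _ G']) (simp add: G'_def)
qed

end

theory Submission
  imports Defs
begin

text \<open>
  The automaton \<open>p\<^sub>M : Q \<rightarrow> C\<close> induces a functor of operads \<open>W[p\<^sub>M] : W[Q] \<rightarrow> W[C]\<close>, and a grammar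
  for the pulled back language is obtained by pulling \<open>p : Free S \<rightarrow> W[C]\<close> back along it.
  Finitarity makes the resulting species finite, and the ULF property lifts each derivation
  of \<open>p\<^sub>M(\<alpha>)\<close> to a derivation of \<open>\<alpha>\<close>. It also makes \<open>Q\<close> finitely generated, by the arrows over
  the generators of \<open>C\<close>. Finally, \<open>L \<inter> L\<^sub>M\<close> is the image under \<open>p\<^sub>M\<close> of the pullback of \<open>L\<close>, and
  context-free languages are closed under functorial image, by composing \<open>p\<close> with \<open>W[p\<^sub>M]\<close>.
\<close>

section \<open>The universal property of the free operad\<close>

primrec free_extension :: "('d, 'f) operad \<Rightarrow> ('c \<Rightarrow> 'd) \<Rightarrow> ('n \<Rightarrow> 'f) \<Rightarrow> ('c, 'n) tree \<Rightarrow> 'f" where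
  "free_extension P \<gamma> \<omega> (Leaf c) = one P (\<gamma> c)"
| "free_extension P \<gamma> \<omega> (Node x ts) = plug P (\<omega> x) (map (free_extension P \<gamma> \<omega>) ts)"

text \<open>The generator of the free operad given by a node. A grammar carries a functor defined on
  all trees, so the spliced arrow attached to a node \<open>x\<close> is read off as its value on
  this tree.\<close>

definition corolla :: "('c, 'n) species \<Rightarrow> 'n \<Rightarrow> ('c, 'n) tree" where
  "corolla S x = Node x (map Leaf (sins S x))"

lemma Node_in_trees_iff:
  "Node x ts \<in> trees S \<longleftrightarrow> x \<in> nodes S \<and> set ts \<subseteq> trees S \<and> map (root S) ts = sins S x"
  by (auto elim: trees.cases intro: trees.Node)

lemma leaves_corolla: "leaves (corolla S x) = sins S x"
  by (simp add: corolla_def comp_def)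

lemma corolla_tree:
  assumes "finite_species S" "x \<in> nodes S"
  shows "corolla S x \<in> trees S"
  using finite_species.sins_scolors[OF assms] assms(2)
  by (auto simp: corolla_def Node_in_trees_iff comp_def intro: trees.Leaf)

text \<open>This turns the recursive structure of trees into operadic composition: a functor that
  preserves plugging can then be unfolded one node at a time.\<close>

lemma graft_corolla:
  assumes "map (root S) ts = sins S x"
  shows "graft (corolla S x) ts = Node x ts"
proof -
  \<comment> \<open>An arbitrary list of colors replaces \<open>sins S x\<close> so that the
    induction can shorten it.\<close>
  have "grafts (map Leaf cs) us = us" if "length us = length cs"
    for cs :: "'a list" and us :: "('a, 'b) tree list"
    using that
  proof (induction cs arbitrary: us)
    case (Cons c cs)
    then show ?case by (cases us) auto
  qed simp
  moreover have "length ts = length (sins S x)"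
    using assms by (metis length_map)
  ultimately show ?thesis by (simp add: corolla_def)
qed

lemma (in operad) free_extension_typing:
  assumes "finite_species S"
    and "\<And>c. c \<in> scolors S \<Longrightarrow> \<gamma> c \<in> colors P"
    and "\<And>x. x \<in> nodes S \<Longrightarrow> \<omega> x \<in> ops P \<and> ins P (\<omega> x) = map \<gamma> (sins S x) \<and> out P (\<omega> x) = \<gamma> (sout S x)"
    and "t \<in> trees S"
  shows "free_extension P \<gamma> \<omega> t \<in> ops P \<and> ins P (free_extension P \<gamma> \<omega> t) = map \<gamma> (leaves t) \<and>
    out P (free_extension P \<gamma> \<omega> t) = \<gamma> (root S t)"
  using assms(4)
proof (induction t rule: trees.induct)
  case (Leaf c)
  then show ?case using assms(2) by (simp add: one_op one_ins one_out)
next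
  case (Node x ts)
  have "map (out P) (map (free_extension P \<gamma> \<omega>) ts) = map \<gamma> (map (root S) ts)"
    using Node.IH by simp
  then have "composable P (\<omega> x) (map (free_extension P \<gamma> \<omega>) ts)"
    using Node assms(3)[of x] by (auto simp: composable_def)
  moreover have "map (ins P) (map (free_extension P \<gamma> \<omega>) ts) = map (map \<gamma>) (map leaves ts)"
    using Node.IH by simp
  ultimately show ?case
    using Node.hyps assms(3)[of x]
    by (simp add: plug_op plug_ins plug_out map_concat del: map_map)
qed

text \<open>Existence half of the universal property: a functor out of a free operad may be
  specified on colors and nodes alone. The work lies in compatibility with grafting, by induction on
  the lower tree: a leaf is the left unit law, a node is associativity of plugging.\<close>

theorem (in operad) operad_functor_free_extension:
  assumes S: "finite_species S"
    and \<gamma>: "\<And>c. c \<in> scolors S \<Longrightarrow> \<gamma> c \<in> colors P"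
    and \<omega>: "\<And>x. x \<in> nodes S \<Longrightarrow> \<omega> x \<in> ops P \<and> ins P (\<omega> x) = map \<gamma> (sins S x) \<and> out P (\<omega> x) = \<gamma> (sout S x)"
  shows "operad_functor (free_operad S) P \<gamma> (free_extension P \<gamma> \<omega>)"
proof -
  interpret free: operad "free_operad S" using S by (rule operad_free_operad)
  note typing = free_extension_typing[OF S \<gamma> \<omega>, simplified]
  have free_extension_graft: "free_extension P \<gamma> \<omega> (graft t us) = plug P (free_extension P \<gamma> \<omega> t) (map (free_extension P \<gamma> \<omega>) us)"
    if "t \<in> trees S" "map (root S) us = leaves t" "set us \<subseteq> trees S" for t us
    using that
  proof (induction t arbitrary: us rule: trees.induct)
    case (Leaf c)
    then obtain u where "us = [u]" "root S u = c" "u \<in> trees S" by (cases us) auto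
    then show ?case using typing[of u] one_plug[of "free_extension P \<gamma> \<omega> u"] by simp
  next
    case (Node x ts)
    let ?e = "free_extension P \<gamma> \<omega>"
    have ts: "set ts \<subseteq> trees S" using Node.IH by auto
    \<comment> \<open>The grafted trees are cut into blocks, one for each subtree in
      \<open>ts\<close>, which is the bracketing that \<open>plug_assoc\<close> asks for.\<close>
    have "map (root S) us = concat (map leaves ts)" using Node.prems by simp
    then obtain uss where uss: "us = concat uss"
        "list_all2 (\<lambda>t us. map (root S) us = leaves t) ts uss"
      by (rule list_split_leaves)
    have len: "list_all2 (\<lambda>t us. length us = length (leaves t)) ts uss"
      by (rule list_all2_mono[OF uss(2)]) (metis length_map)
    have "map (out P) (map ?e ts) = map \<gamma> (map (root S) ts)"
      using ts typing by auto
    then have comp: "composable P (\<omega> x) (map ?e ts)"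
      using Node.hyps ts typing \<omega>[of x] by (auto simp: composable_def)
    have "list_all2 (composable P) (map ?e ts) (map (map ?e) uss) \<and>
        map ?e (map2 graft ts uss) = map2 (plug P) (map ?e ts) (map (map ?e) uss)"
      using uss(2) Node.IH Node.prems(2) unfolding uss(1)
    proof (induction ts uss rule: list_all2_induct)
      case (Cons t ts us uss)
      have "map (out P) (map ?e us) = map \<gamma> (map (root S) us)"
        using Cons.prems typing by auto
      then have "composable P (?e t) (map ?e us)"
        using Cons.hyps Cons.prems typing by (auto simp: composable_def)
      then show ?case using Cons by auto
    qed simp
    then have "plug P (plug P (\<omega> x) (map ?e ts)) (concat (map (map ?e) uss))
        = plug P (\<omega> x) (map ?e (map2 graft ts uss))"
      using plug_assoc[OF comp] by simp
    then show ?case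
      using grafts_concat[OF len] uss(1) by (simp add: map_concat del: map_map)
  qed
  show ?thesis
    by unfold_locales
      (use \<gamma> typing free_extension_graft in \<open>auto simp: free_operad_def composable_def\<close>)
qed

lemma (in operad_functor) operad_functor_comp:
  assumes "operad_functor O2 O3 qc qo"
  shows "operad_functor O1 O3 (qc \<circ> pc) (qo \<circ> po)"
proof -
  interpret q: operad_functor O2 O3 qc qo by fact
  have "composable O2 (po f) (map po gs)" if "composable O1 f gs" for f gs
  proof -
    have "set gs \<subseteq> ops O1" using that by (simp add: composable_def)
    then have "map (out O2) (map po gs) = map pc (map (out O1) gs)"
      by (auto simp: map_out)
    then show ?thesis
      using that by (auto simp: composable_def map_op map_ins simp del: map_map)
  qed
  then show ?thesis
    by unfold_locales
      (simp_all add: map_color map_op map_ins map_out map_one map_plug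
        q.map_color q.map_op q.map_ins q.map_out q.map_one q.map_plug)
qed

section \<open>Spliced arrows and functors\<close>

context cat_functor
begin

lemma map_arr:
  assumes "f \<in> arr Q"
  shows "Fa f \<in> arr C" "src C (Fa f) = Fo (src Q f)" "tgt C (Fa f) = Fo (tgt Q f)"
  using map_hom[OF assms] by (auto simp: hom_def)

lemma map_arrs:
  assumes "dom.arrs ws"
  shows "cod.arrs (map Fa ws)" "src C (hd (map Fa ws)) = Fo (src Q (hd ws))"
    "tgt C (last (map Fa ws)) = Fo (tgt Q (last ws))"
  using assms by (auto simp: dom.arrs_def cod.arrs_def last_map hd_map map_arr subset_iff)

lemma gaps_map: "dom.arrs ws \<Longrightarrow> cod.gaps (map Fa ws) = map (map_prod Fo Fo) (dom.gaps ws)"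
  by (induction ws rule: dom.arrs_induct)
    (auto simp: dom.gaps_simps cod.gaps_simps dom.arrs_Cons map_arr)

text \<open>Only the seam between the two lists is a composite, so functoriality is used once,
  there.\<close>

lemma map_glue:
  assumes "dom.arrs vs" "dom.arrs ws" "tgt Q (last vs) = src Q (hd ws)"
  shows "map Fa (glue Q vs ws) = glue C (map Fa vs) (map Fa ws)"
  using assms unfolding glue_def
  by (auto simp: dom.arrs_def last_map hd_map map_butlast map_tl subset_iff intro!: map_cmp)

lemma map_splice:
  assumes "dom.arrs ws" "dom.fits ws us"
  shows "map Fa (splice Q ws us) = splice C (map Fa ws) (map (map Fa) us)"
  using assms
proof (induction ws arbitrary: us rule: dom.arrs_induct)
  case (single w)
  then show ?case by (simp add: dom.fits_simps)
next
  case (Cons w w' f)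
  then obtain u us' where us: "us = u # us'" "dom.arrs u" "src Q (hd u) = tgt Q w"
    "tgt Q (last u) = src Q w'" "dom.fits (w' # f) us'" by (auto simp: dom.fits_simps)
  note 1 = dom.single_glue_typing[OF us(2) Cons.hyps(1) us(3)]
  note 2 = dom.splice_typing[OF Cons.hyps(2) us(5)]
  have "map Fa (glue Q [w] u) = glue C [Fa w] (map Fa u)"
    using map_glue[of "[w]" u] Cons.hyps us by (simp add: dom.arrs_Cons)
  then show ?case
    using 1 2 us Cons.IH[OF us(5)] by (simp add: map_glue)
qed

text \<open>Functoriality of the construction \<open>W[-]\<close>: splicing is built from
  composition alone, so applying the functor to each arrow respects it.\<close>

theorem operad_functor_spliced_arrows:
  "operad_functor (spliced_arrows Q) (spliced_arrows C) (map_prod Fo Fo) (map Fa)"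
proof -
  interpret O1: operad "spliced_arrows Q" by (rule dom.operad_spliced_arrows)
  interpret O2: operad "spliced_arrows C" by (rule cod.operad_spliced_arrows)
  show ?thesis
  proof (unfold_locales, goal_cases)
    case (3 ws)
    then have "dom.arrs ws" by (auto simp: spliced_arrows_def dom.arrs_def)
    from gaps_map[OF this] show ?case
      by (simp add: spliced_arrows_def dom.gaps_def cod.gaps_def)
  next
    case (4 ws)
    then have "dom.arrs ws" by (auto simp: spliced_arrows_def dom.arrs_def)
    from map_arrs[OF this] show ?case by (simp add: spliced_arrows_def)
  next
    case (6 ws us)
    then show ?case
      unfolding dom.composable_spliced_arrows by (simp add: spliced_arrows_def map_splice)
  qed (auto simp: spliced_arrows_def map_obj map_ident map_arr)
qed

text \<open>Derivation trees and start color stay the same and only their evaluation changes, so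
  every word is replaced by its image. Finite generation is demanded of \<open>C\<close> because it
  becomes the category of the new grammar.\<close>

theorem context_free_language_image:
  assumes "context_free_language Q A B L" "finitely_generated C"
  shows "context_free_language C (Fo A) (Fo B) (Fa ` L)"
proof -
  obtain G :: "('q, 'b, nat, nat) grammar" where G: "context_free_grammar G" "gcat G = Q"
    "gcol G (start G) = (A, B)" "language G = L"
    using assms(1) by (auto simp: context_free_language_def)
  interpret p: operad_functor "free_operad (gspecies G)" "spliced_arrows Q" "gcol G" "gop G"
    using G by (simp add: context_free_grammar_def)
  define G' where "G' = \<lparr>gcat = C, gspecies = gspecies G, start = start G,
    gcol = map_prod Fo Fo \<circ> gcol G, gop = map Fa \<circ> gop G\<rparr>"
  have "context_free_grammar G'"
    using G assms(2) p.operad_functor_comp[OF operad_functor_spliced_arrows] cod.category_axioms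
    by (simp add: context_free_grammar_def G'_def)
  \<comment> \<open>A list that \<open>map Fa\<close> sends to a singleton is itself a singleton, so
    a tree evaluates to a word of the new grammar only if it already did so in the old one.\<close>
  moreover have "language G' = Fa ` L"
    by (auto simp: language_def G'_def G(4)[symmetric] map_eq_Cons_conv)
  ultimately show ?thesis
    using G(3) unfolding context_free_language_def
    by (intro exI[of _ G']) (simp add: G'_def)
qed

end

section \<open>Lifting along ULF functors\<close>

context ulf_functor
begin

text \<open>The existence half of the ULF property; uniqueness enters only through
  \<open>arr_over_ident\<close>.\<close>

lemma lift_factorization:
  assumes "\<alpha> \<in> arr Q" "u \<in> arr C" "v \<in> arr C" "tgt C u = src C v" "Fa \<alpha> = cmp C u v"
  obtains \<beta> \<gamma> where "\<beta> \<in> arr Q" "\<gamma> \<in> arr Q" "tgt Q \<beta> = src Q \<gamma>" "\<alpha> = cmp Q \<beta> \<gamma>"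
    "Fa \<beta> = u" "Fa \<gamma> = v"
  using unique_factorization_lifting[OF assms] by blast

text \<open>Both factorizations \<open>\<alpha> = id \<alpha>\<close> and \<open>\<alpha> = \<alpha> id\<close> lie over \<open>id = id id\<close>.\<close>
lemma arr_over_ident:
  assumes "\<alpha> \<in> arr Q" "A \<in> obj C" "Fa \<alpha> = ident C A"
  shows "\<alpha> = ident Q (src Q \<alpha>)"
proof -
  have s: "src Q \<alpha> \<in> obj Q" "tgt Q \<alpha> \<in> obj Q"
    using assms(1) by (auto intro: dom.src_obj dom.tgt_obj)
  have A: "Fo (src Q \<alpha>) = A" "Fo (tgt Q \<alpha>) = A"
    using map_arr[OF assms(1)] cod.ident_simps[OF assms(2)] assms(3) by auto
  have "cmp C (ident C A) (ident C A) = ident C A"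
    using cod.ident_cmp[of "ident C A"] cod.ident_simps[OF assms(2)] by simp
  from unique_factorization_lifting[OF assms(1), of "ident C A" "ident C A"]
  have "\<exists>!(\<beta>, \<gamma>). \<beta> \<in> arr Q \<and> \<gamma> \<in> arr Q \<and> tgt Q \<beta> = src Q \<gamma>
      \<and> \<alpha> = cmp Q \<beta> \<gamma> \<and> Fa \<beta> = ident C A \<and> Fa \<gamma> = ident C A"
    using \<open>cmp C (ident C A) (ident C A) = ident C A\<close> assms cod.ident_simps[OF assms(2)] by simp
  from ex1_implies_ex[OF this] this have "(ident Q (src Q \<alpha>), \<alpha>) = (\<alpha>, ident Q (tgt Q \<alpha>))"
    by (elim ex1E) (use assms A s in
      \<open>simp add: dom.ident_simps dom.ident_cmp dom.cmp_ident map_ident split: prod.splits; metis\<close>)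
  then show ?thesis by simp
qed

text \<open>Induction on how the image of \<alpha> is generated, with the arrow above it arbitrary:
  over an identity there are only identities, and over a composite the arrow splits into factors
  lying over the two parts.\<close>

lemma generated_lift:
  assumes "generated C E = arr C" "E \<subseteq> arr C" "\<alpha> \<in> arr Q"
  shows "\<alpha> \<in> generated Q {\<beta> \<in> arr Q. Fa \<beta> \<in> E}"
proof -
  have "w \<in> generated C E \<Longrightarrow> \<alpha> \<in> arr Q \<Longrightarrow> Fa \<alpha> = w \<Longrightarrow>
      \<alpha> \<in> generated Q {\<beta> \<in> arr Q. Fa \<beta> \<in> E}" for w \<alpha>
  proof (induction arbitrary: \<alpha> rule: generated.induct)
    case (ident A)
    then have "\<alpha> = ident Q (src Q \<alpha>)" by (intro arr_over_ident)
    then show ?case using ident dom.src_obj by (metis generated.ident)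
  next
    case (base e)
    then show ?case by (auto intro: generated.base)
  next
    case (cmp f g)
    then obtain \<beta> \<gamma> where "\<beta> \<in> arr Q" "\<gamma> \<in> arr Q" "tgt Q \<beta> = src Q \<gamma>" "\<alpha> = cmp Q \<beta> \<gamma>"
      "Fa \<beta> = f" "Fa \<gamma> = g"
      using lift_factorization[of \<alpha> f g] unfolding assms(1) by blast
    then show ?case using cmp.IH by (auto intro: generated.cmp)
  qed
  with assms map_arr(1) show ?thesis by metis
qed

lemma generated_subset_arr: "E \<subseteq> arr Q \<Longrightarrow> generated Q E \<subseteq> arr Q"
proof
  fix \<alpha> assume "\<alpha> \<in> generated Q E" "E \<subseteq> arr Q"
  then show "\<alpha> \<in> arr Q"
    by (induction rule: generated.induct) (auto simp: dom.ident_simps dom.cmp_simps)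
qed

text \<open>Plugging only constants into \<open>ws\<close> yields a plain iterated composite in \<open>C\<close>, which is why
  iterating the ULF property suffices.\<close>
lemma lift_splice:
  assumes "cod.arrs ws" "cod.fits ws (map (\<lambda>v. [v]) vs)" "\<alpha> \<in> arr Q"
    and "splice C ws (map (\<lambda>v. [v]) vs) = [Fa \<alpha>]"
  shows "\<exists>\<alpha>s \<beta>s. dom.arrs \<alpha>s \<and> dom.fits \<alpha>s (map (\<lambda>\<beta>. [\<beta>]) \<beta>s) \<and> map Fa \<alpha>s = ws \<and>
    map Fa \<beta>s = vs \<and> splice Q \<alpha>s (map (\<lambda>\<beta>. [\<beta>]) \<beta>s) = [\<alpha>]"
  using assms
proof (induction ws arbitrary: vs \<alpha> rule: cod.arrs_induct)
  case (single w)
  then show ?case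
    by (intro exI[of _ "[\<alpha>]"] exI[of _ "[]"]) (auto simp: cod.fits_simps dom.fits_simps dom.arrs_Cons)
next
  case (Cons w w' f)
  from Cons.prems(1) obtain v vs' where vs: "vs = v # vs'" "v \<in> arr C" "src C v = tgt C w"
    "tgt C v = src C w'" "cod.fits (w' # f) (map (\<lambda>v. [v]) vs')"
    by (auto simp: cod.fits_simps cod.arrs_Cons)
  note typing = cod.splice_typing[OF Cons.hyps(2) vs(5)]
  then obtain r rs where r: "splice C (w' # f) (map (\<lambda>v. [v]) vs') = r # rs"
    by (cases "splice C (w' # f) (map (\<lambda>v. [v]) vs')") (auto simp: cod.arrs_def)
  with Cons.prems(3) vs(1) have rs: "rs = []" and \<alpha>: "Fa \<alpha> = cmp C (cmp C w v) r"
    by (auto simp: cod.glue_simps)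
  have rt: "r \<in> arr C" "src C r = src C w'"
    using typing r by (auto simp: cod.arrs_Cons)
  note wv = cod.cmp_simps[OF Cons.hyps(1) vs(2) vs(3)[symmetric]]
  \<comment> \<open>The word is peeled from the left: \<alpha> splits over \<open>cmp C w v\<close>
    and the remaining product \<open>r\<close>, then the first factor splits over \<open>w\<close>
    and \<open>v\<close>. The induction hypothesis applies to the factor \<rho> over
    \<open>r\<close>.\<close>
  obtain \<delta> \<rho> where \<delta>: "\<delta> \<in> arr Q" "\<rho> \<in> arr Q" "tgt Q \<delta> = src Q \<rho>" "\<alpha> = cmp Q \<delta> \<rho>"
    "Fa \<delta> = cmp C w v" "Fa \<rho> = r"
    using lift_factorization[OF Cons.prems(2) wv(1) rt(1) _ \<alpha>] wv rt vs(4) by metis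
  obtain a b where ab: "a \<in> arr Q" "b \<in> arr Q" "tgt Q a = src Q b" "\<delta> = cmp Q a b"
    "Fa a = w" "Fa b = v"
    using lift_factorization[OF \<delta>(1) Cons.hyps(1) vs(2) vs(3)[symmetric] \<delta>(5)] by metis
  obtain \<alpha>s \<beta>s where IH: "dom.arrs \<alpha>s" "dom.fits \<alpha>s (map (\<lambda>\<beta>. [\<beta>]) \<beta>s)" "map Fa \<alpha>s = w' # f"
    "map Fa \<beta>s = vs'" "splice Q \<alpha>s (map (\<lambda>\<beta>. [\<beta>]) \<beta>s) = [\<rho>]"
    using Cons.IH[OF vs(5) \<delta>(2)] r rs \<delta>(6) by auto
  from IH(3) obtain a' \<alpha>s' where as: "\<alpha>s = a' # \<alpha>s'" by auto
  \<comment> \<open>These two equations show that \<open>b\<close> ends where the lifted tail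
    begins, so it fits into the first gap of \<open>a # \<alpha>s\<close>.\<close>
  have "src Q a' = src Q \<rho>" using dom.splice_typing[OF IH(1,2)] IH(5) as by simp
  moreover have "tgt Q \<delta> = tgt Q b" using dom.cmp_simps[OF ab(1,2,3)] ab(4) by simp
  ultimately show ?case
    using IH ab \<delta> vs(1) as
    by (intro exI[of _ "a # \<alpha>s"] exI[of _ "b # \<beta>s"])
      (auto simp: dom.fits_simps dom.arrs_Cons dom.glue_simps)
qed

end

section \<open>Finiteness above a finitely generated category, and the pullback grammar\<close>

locale finitary_ulf_functor = ulf_functor + finitary_functor
begin

lemma finite_obj_dom: "finite (obj C) \<Longrightarrow> finite (obj Q)"
  by (rule finite_subset[of _ "\<Union>A \<in> obj C. {q \<in> obj Q. Fo q = A}"])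
    (auto simp: map_obj finite_obj_fiber)

theorem finitely_generated_dom:
  assumes "finitely_generated C"
  shows "finitely_generated Q"
proof -
  obtain E where E: "finite E" "E \<subseteq> arr C" "generated C E = arr C" and "finite (obj C)"
    using assms by (auto simp: finitely_generated_def)
  let ?E = "{\<beta> \<in> arr Q. Fa \<beta> \<in> E}"
  have "finite (\<Union>e \<in> E. {\<beta> \<in> arr Q. Fa \<beta> = e})"
    using E by (auto intro: finite_arr_fiber)
  then have "finite ?E" by (rule rev_finite_subset) auto
  moreover have "generated Q ?E = arr Q"
    using generated_lift[OF E(3,2)] generated_subset_arr[of ?E] by auto
  ultimately show ?thesis
    using finite_obj_dom[OF \<open>finite (obj C)\<close>]
    unfolding finitely_generated_def by (intro conjI exI[of _ ?E]) auto
qed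

text \<open>The letters of a lift come from finitely many finite fibers and its length is fixed.
  This bounds the nodes of the pullback species.\<close>

lemma finite_lifts:
  assumes "set ws \<subseteq> arr C"
  shows "finite {\<alpha>s. set \<alpha>s \<subseteq> arr Q \<and> map Fa \<alpha>s = ws}"
proof (rule finite_subset)
  show "{\<alpha>s. set \<alpha>s \<subseteq> arr Q \<and> map Fa \<alpha>s = ws} \<subseteq>
      {\<alpha>s. set \<alpha>s \<subseteq> (\<Union>w \<in> set ws. {\<alpha> \<in> arr Q. Fa \<alpha> = w}) \<and> length \<alpha>s = length ws}"
    by auto
  show "finite \<dots>"
    using assms by (intro finite_lists_length_eq) (auto intro: finite_arr_fiber)
qed

text \<open>The two inclusions are inductions on trees without leaves: \<open>project_ev\<close>
  forgets the lifts chosen at the nodes, and \<open>lift\<close> chooses them so that the result is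
  a prescribed arrow of \<open>Q\<close>.\<close>

theorem context_free_language_pullback:
  assumes "finitely_generated C" "context_free_language C (Fo q0) (Fo qf) L"
    and q: "q0 \<in> obj Q" "qf \<in> obj Q"
  shows "context_free_language Q q0 qf {\<alpha> \<in> hom Q q0 qf. Fa \<alpha> \<in> L}"
proof -
  obtain G :: "('c, 'd, nat, nat) grammar" where G: "context_free_grammar G" "gcat G = C"
    "gcol G (start G) = (Fo q0, Fo qf)" "language G = L"
    using assms(2) by (auto simp: context_free_language_def)
  define S where "S = gspecies G"
  have S: "finite_species S" using G by (simp add: S_def context_free_grammar_def)
  then interpret S: finite_species S .
  interpret p: operad_functor "free_operad S" "spliced_arrows C" "gcol G" "gop G"
    using G by (simp add: S_def context_free_grammar_def)
  interpret WQ: operad "spliced_arrows Q" by (rule dom.operad_spliced_arrows)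
  let ?g = "gop G"
  have g_typing: "cod.arrs (?g t) \<and> cod.gaps (?g t) = map (gcol G) (leaves t)"
    if "t \<in> trees S" for t
    using p.map_op[of t] p.map_ins[of t] that
    by (auto simp: free_operad_def spliced_arrows_def cod.arrs_def cod.gaps_def)
  \<comment> \<open>The functor of the grammar is not given by recursion on trees; its recursion at
    a node is recovered here from its values on corollas.\<close>
  have g_Node: "?g (Node x ts) = splice C (?g (corolla S x)) (map ?g ts)"
    and fits_Node: "cod.fits (?g (corolla S x)) (map ?g ts)"
    if "Node x ts \<in> trees S" for x ts
  proof -
    have x: "x \<in> nodes S" "set ts \<subseteq> trees S" "map (root S) ts = sins S x"
      using that by (auto simp: Node_in_trees_iff)
    then have c: "composable (free_operad S) (corolla S x) ts"
      using corolla_tree[OF S x(1)] by (simp add: composable_def free_operad_def leaves_corolla)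
    from p.map_plug[OF c] graft_corolla[OF x(3)]
    show "?g (Node x ts) = splice C (?g (corolla S x)) (map ?g ts)"
      by (simp add: free_operad_def spliced_arrows_def)
    have "map (out (spliced_arrows C)) (map ?g ts) = map (gcol G) (map (root S) ts)"
      using x(2) p.map_out by (auto simp: free_operad_def)
    then have "composable (spliced_arrows C) (?g (corolla S x)) (map ?g ts)"
      using x p.map_op p.map_ins[of "corolla S x"] corolla_tree[OF S x(1)]
      by (auto simp: composable_def free_operad_def leaves_corolla simp del: map_map)
    then show "cod.fits (?g (corolla S x)) (map ?g ts)"
      by (simp add: cod.composable_spliced_arrows)
  qed

  \<comment> \<open>The pullback of \<open>S\<close> along \<open>W[p\<^sub>M]\<close>: a node is a node of \<open>S\<close> with a lift of its image.
    Triples \<open>(R, q, q')\<close> with \<open>(Fo q, Fo q') \<noteq> gcol G R\<close> are kept as colors; this is harmless because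
    they are the output of no node.\<close>
  define S' where "S' = \<lparr>scolors = scolors S \<times> obj Q \<times> obj Q,
    nodes = (SIGMA x : nodes S. {\<alpha>s. set \<alpha>s \<subseteq> arr Q \<and> map Fa \<alpha>s = ?g (corolla S x)}),
    sins = (\<lambda>(x, \<alpha>s). zip (sins S x) (dom.gaps \<alpha>s)),
    sout = (\<lambda>(x, \<alpha>s). (sout S x, src Q (hd \<alpha>s), tgt Q (last \<alpha>s)))\<rparr>"
  \<comment> \<open>Colors and nodes of \<open>S'\<close> both carry their part in \<open>Q\<close>
    as second component, a pair of states or a lifted spliced arrow, so \<open>snd\<close> serves
    for both.\<close>
  define ev where "ev = free_extension (spliced_arrows Q) (snd :: nat \<times> _ \<Rightarrow> _) (snd :: nat \<times> _ \<Rightarrow> _)"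
  have ev_Node: "ev (Node (x, \<alpha>s) ts) = splice Q \<alpha>s (map ev ts)" for x \<alpha>s ts
    by (simp add: ev_def spliced_arrows_def)
  \<comment> \<open>The equality of lengths matters because \<open>sins S'\<close> is a
    \<open>zip\<close>, which would otherwise drop inputs silently; it holds because lifting
    preserves the number of gaps.\<close>
  have node: "dom.arrs \<alpha>s" "length (dom.gaps \<alpha>s) = length (sins S x)" "x \<in> nodes S"
    "map Fa \<alpha>s = ?g (corolla S x)" "set (dom.gaps \<alpha>s) \<subseteq> obj Q \<times> obj Q"
    if "(x, \<alpha>s) \<in> nodes S'" for x \<alpha>s
  proof -
    show x: "x \<in> nodes S" and m: "map Fa \<alpha>s = ?g (corolla S x)"
      using that by (auto simp: S'_def)
    have t: "cod.arrs (?g (corolla S x))" "cod.gaps (?g (corolla S x)) = map (gcol G) (sins S x)"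
      using g_typing[OF corolla_tree[OF S x]] by (auto simp: leaves_corolla)
    then have "\<alpha>s \<noteq> []" using m by (auto simp: cod.arrs_def)
    then show a: "dom.arrs \<alpha>s" using that by (simp add: S'_def dom.arrs_def)
    show "length (dom.gaps \<alpha>s) = length (sins S x)"
      using gaps_map[OF a] m t by (metis length_map)
    show "set (dom.gaps \<alpha>s) \<subseteq> obj Q \<times> obj Q"
      using WQ.ins_colors[of \<alpha>s] a by (simp add: spliced_arrows_def dom.arrs_def dom.gaps_def)
  qed
  have S': "finite_species S'"
  proof (unfold_locales, goal_cases)
    case 1
    show ?case
      using S.finite_scolors finite_obj_dom assms(1) by (simp add: S'_def finitely_generated_def)
  next
    case 2
    have "finite {\<alpha>s. set \<alpha>s \<subseteq> arr Q \<and> map Fa \<alpha>s = ?g (corolla S x)}" if "x \<in> nodes S" for x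
      using g_typing[OF corolla_tree[OF S that]] by (intro finite_lifts) (simp add: cod.arrs_def)
    then show ?case using S.finite_nodes by (simp add: S'_def)
  next
    case (3 y)
    obtain x \<alpha>s where y: "y = (x, \<alpha>s)" by fastforce
    then have n: "(x, \<alpha>s) \<in> nodes S'" using 3 by simp
    have "set (zip (sins S x) (dom.gaps \<alpha>s)) \<subseteq> set (sins S x) \<times> set (dom.gaps \<alpha>s)"
      by (auto dest: set_zip_leftD set_zip_rightD)
    also have "\<dots> \<subseteq> scolors S \<times> obj Q \<times> obj Q"
      by (intro Sigma_mono S.sins_scolors node(3,5)[OF n])
    finally show ?case by (simp add: S'_def y)
  next
    case (4 y)
    obtain x \<alpha>s where y: "y = (x, \<alpha>s)" by fastforce
    with 4 have n: "(x, \<alpha>s) \<in> nodes S'" by simp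
    have "hd \<alpha>s \<in> arr Q" "last \<alpha>s \<in> arr Q"
      using node(1)[OF n] by (auto simp: dom.arrs_def)
    then have "src Q (hd \<alpha>s) \<in> obj Q" "tgt Q (last \<alpha>s) \<in> obj Q"
      by (simp_all add: dom.src_obj dom.tgt_obj)
    with S.sout_scolor[OF node(3)[OF n]] show ?case by (simp add: S'_def y)
  qed
  have ev: "operad_functor (free_operad S') (spliced_arrows Q) snd ev"
    unfolding ev_def
  proof (rule WQ.operad_functor_free_extension[OF S'])
    show "snd c \<in> colors (spliced_arrows Q)" if "c \<in> scolors S'" for c
      using that by (auto simp: S'_def spliced_arrows_def)
    show "snd y \<in> ops (spliced_arrows Q) \<and> ins (spliced_arrows Q) (snd y) = map snd (sins S' y) \<and>
        out (spliced_arrows Q) (snd y) = snd (sout S' y)" if "y \<in> nodes S'" for y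
    proof -
      obtain x \<alpha>s where y: "y = (x, \<alpha>s)" by fastforce
      with that have n: "(x, \<alpha>s) \<in> nodes S'" by simp
      have "map snd (sins S' y) = dom.gaps \<alpha>s"
        using node(2)[OF n] by (simp add: S'_def y)
      then show ?thesis
        using node(1)[OF n] by (simp add: y spliced_arrows_def S'_def dom.arrs_def dom.gaps_def)
    qed
  qed
  then interpret ev: operad_functor "free_operad S'" "spliced_arrows Q" snd ev .

  \<comment> \<open>The other leg of the pullback, from \<open>Free S'\<close> to
    \<open>Free S\<close>, is a relabelling that forgets states and lifts.\<close>
  have project: "map_tree fst fst t \<in> trees S \<and> root S (map_tree fst fst t) = fst (root S' t)"
    if "t \<in> trees S'" for t
    using that
  proof (rule trees_map_tree)
    fix y assume y: "y \<in> nodes S'"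
    obtain x \<alpha>s where xs: "y = (x, \<alpha>s)" by fastforce
    with y have n: "(x, \<alpha>s) \<in> nodes S'" by simp
    show "fst y \<in> nodes S \<and> sins S (fst y) = map fst (sins S' y) \<and> sout S (fst y) = fst (sout S' y)"
      using node(2,3)[OF n] by (simp add: S'_def xs)
  qed (auto simp: S'_def)

  have fits_ev: "dom.fits \<alpha>s (map ev ts)" if "Node (x, \<alpha>s) ts \<in> trees S'" for x \<alpha>s ts
  proof -
    have n: "(x, \<alpha>s) \<in> nodes S'" "set ts \<subseteq> trees S'" "map (root S') ts = sins S' (x, \<alpha>s)"
      using that by (auto simp: Node_in_trees_iff)
    have "map (out (spliced_arrows Q)) (map ev ts) = map snd (map (root S') ts)"
      using n(2) ev.map_out by (auto simp: free_operad_def)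
    also have "\<dots> = dom.gaps \<alpha>s"
      using n(3) node[OF n(1)] by (simp add: S'_def del: map_map)
    finally show ?thesis
      using n ev.map_op by (auto simp: dom.fits_def spliced_arrows_def free_operad_def dom.arrs_def)
  qed

  \<comment> \<open>Commutativity of the pullback square, for trees without leaves. On a leaf
    \<open>(R, q, q')\<close> with \<open>(Fo q, Fo q')\<close> different from
    \<open>gcol G R\<close> it would fail, as the two sides are then identities on different
    colors.\<close>
  have project_ev: "map Fa (ev t) = ?g (map_tree fst fst t)" if "t \<in> trees S'" "leaves t = []" for t
    using that
  proof (induction t rule: trees.induct)
    case (Node y ts)
    obtain x \<alpha>s where y: "y = (x, \<alpha>s)" by fastforce
    have t: "Node (x, \<alpha>s) ts \<in> trees S'" using Node y by (auto intro: trees.Node)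
    have n: "(x, \<alpha>s) \<in> nodes S'" using Node y by simp
    have IH: "map (map Fa) (map ev ts) = map ?g (map (map_tree fst fst) ts)"
      using Node by auto
    have "map Fa (ev (Node y ts)) = splice C (map Fa \<alpha>s) (map (map Fa) (map ev ts))"
      using map_splice[OF node(1)[OF n] fits_ev[OF t]] by (simp add: y ev_Node)
    also have "\<dots> = ?g (Node x (map (map_tree fst fst) ts))"
      using g_Node[of x "map (map_tree fst fst) ts"] project[OF t] node(4)[OF n]
      by (simp add: IH del: map_map)
    finally show ?case by (simp add: y)
  qed simp

  \<comment> \<open>The root color is part of the claim so that the lifted subtrees match the inputs
    of the lifted node above them.\<close>
  have lift: "\<exists>t'. t' \<in> trees S' \<and> leaves t' = [] \<and> root S' t' = (root S t, src Q \<alpha>, tgt Q \<alpha>) \<and> ev t' = [\<alpha>]"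
    if "t \<in> trees S" "leaves t = []" "\<alpha> \<in> arr Q" "?g t = [Fa \<alpha>]" for t \<alpha>
    using that
  proof (induction t arbitrary: \<alpha> rule: trees.induct)
    case (Node x ts)
    have t: "Node x ts \<in> trees S" using Node by (auto intro: trees.Node)
    have closed: "\<exists>v. ?g s = [v]" if "s \<in> set ts" for s
    proof -
      have s: "s \<in> trees S" "leaves s = []" using that Node by auto
      \<comment> \<open>\<open>remdups_adj.cases\<close> serves as the split into empty, singleton
        and longer lists; a longer list would have a gap, but \<open>s\<close> has no
        leaves.\<close>
      with g_typing[of s] show ?thesis
        by (cases "?g s" rule: remdups_adj.cases) (auto simp: cod.arrs_def cod.gaps_simps)
    qed
    define vs where "vs = map (\<lambda>s. hd (?g s)) ts"
    have vs: "map ?g ts = map (\<lambda>v. [v]) vs"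
      using closed by (fastforce simp: vs_def)
    have w: "cod.arrs (?g (corolla S x))"
      using g_typing[OF corolla_tree[OF S Node.hyps(1)]] by simp
    obtain \<alpha>s \<beta>s where lifts: "dom.arrs \<alpha>s" "dom.fits \<alpha>s (map (\<lambda>\<beta>. [\<beta>]) \<beta>s)"
      "map Fa \<alpha>s = ?g (corolla S x)" "map Fa \<beta>s = vs" "splice Q \<alpha>s (map (\<lambda>\<beta>. [\<beta>]) \<beta>s) = [\<alpha>]"
      using lift_splice[OF w, of vs \<alpha>] fits_Node[OF t] g_Node[OF t] Node.prems vs by auto
    have \<beta>s: "set \<beta>s \<subseteq> arr Q" "map (\<lambda>\<beta>. (src Q \<beta>, tgt Q \<beta>)) \<beta>s = dom.gaps \<alpha>s"
      using lifts(2) by (auto simp: dom.fits_def dom.arrs_def comp_def)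
    have len: "length \<beta>s = length ts" using lifts(4) vs_def by (metis length_map)
    \<comment> \<open>Lifts are chosen by position, since equal subtrees at different positions may
      lie under different arrows of \<open>\<beta>s\<close>.\<close>
    have "\<forall>i < length ts. \<exists>t'. t' \<in> trees S' \<and> leaves t' = [] \<and>
        root S' t' = (root S (ts ! i), src Q (\<beta>s ! i), tgt Q (\<beta>s ! i)) \<and> ev t' = [\<beta>s ! i]"
    proof (intro allI impI)
      fix i assume i: "i < length ts"
      have "?g (ts ! i) = [vs ! i]" using vs i
        by (metis length_map nth_map)
      also have "vs ! i = Fa (\<beta>s ! i)" using lifts(4) i len by auto
      finally have "?g (ts ! i) = [Fa (\<beta>s ! i)]" .
      moreover have "leaves (ts ! i) = []" using Node.prems(1) i by simp
      moreover have "\<beta>s ! i \<in> arr Q" using \<beta>s(1) i len by auto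
      ultimately show "\<exists>t'. t' \<in> trees S' \<and> leaves t' = [] \<and>
        root S' t' = (root S (ts ! i), src Q (\<beta>s ! i), tgt Q (\<beta>s ! i)) \<and> ev t' = [\<beta>s ! i]"
        using Node.IH i nth_mem by blast
    qed
    then obtain f where f: "\<And>i. i < length ts \<Longrightarrow> f i \<in> trees S' \<and> leaves (f i) = [] \<and>
        root S' (f i) = (root S (ts ! i), src Q (\<beta>s ! i), tgt Q (\<beta>s ! i)) \<and> ev (f i) = [\<beta>s ! i]"
      by metis
    define ts' where "ts' = map f [0..<length ts]"
    have ts': "set ts' \<subseteq> trees S'" "\<forall>s \<in> set ts'. leaves s = []"
      using f by (auto simp: ts'_def)
    have ev_ts': "map ev ts' = map (\<lambda>\<beta>. [\<beta>]) \<beta>s"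
      using f len by (intro nth_equalityI) (auto simp: ts'_def)
    have "map (root S') ts' = zip (map (root S) ts) (map (\<lambda>\<beta>. (src Q \<beta>, tgt Q \<beta>)) \<beta>s)"
      using f len by (intro nth_equalityI) (auto simp: ts'_def)
    then have "map (root S') ts' = sins S' (x, \<alpha>s)"
      using Node.hyps \<beta>s(2) by (simp add: S'_def)
    moreover have "(x, \<alpha>s) \<in> nodes S'"
      using Node.hyps lifts by (simp add: S'_def dom.arrs_def)
    ultimately have "Node (x, \<alpha>s) ts' \<in> trees S'" using ts' by (simp add: Node_in_trees_iff)
    moreover have "src Q (hd \<alpha>s) = src Q \<alpha>" "tgt Q (last \<alpha>s) = tgt Q \<alpha>"
      using dom.splice_typing[OF lifts(1,2)] lifts(5) by auto
    ultimately show ?case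
      using ts' lifts(5) by (intro exI[of _ "Node (x, \<alpha>s) ts'"]) (simp add: ev_Node ev_ts' S'_def)
  qed simp

  define G' where "G' = \<lparr>gcat = Q, gspecies = S', start = (start G, q0, qf), gcol = snd, gop = ev\<rparr>"
  have "start G \<in> scolors S" using G by (simp add: context_free_grammar_def S_def)
  then have "start G' \<in> scolors S'" using q by (simp add: G'_def S'_def)
  then have "context_free_grammar G'"
    using S' ev finitely_generated_dom[OF assms(1)] dom.category_axioms
    by (simp add: context_free_grammar_def G'_def)
  \<comment> \<open>The colors and nodes of \<open>G'\<close> are not natural numbers;
    \<open>context_free_language_language\<close> renames them.\<close>
  then have "context_free_language Q q0 qf (language G')"
    using context_free_language_language[of G' q0 qf] by (simp add: G'_def)
  also have "language G' = {\<alpha> \<in> hom Q q0 qf. Fa \<alpha> \<in> L}"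
  proof (intro equalityI subsetI)
    fix \<alpha> assume "\<alpha> \<in> language G'"
    then obtain t where t: "t \<in> trees S'" "leaves t = []" "root S' t = (start G, q0, qf)" "ev t = [\<alpha>]"
      by (auto simp: language_def G'_def constants_def free_operad_def)
    have "\<alpha> \<in> hom Q q0 qf"
      using ev.map_op[of t] ev.map_out[of t] t by (simp add: free_operad_def spliced_arrows_def hom_def)
    moreover have "?g (map_tree fst fst t) = [Fa \<alpha>]"
      using project_ev[OF t(1,2)] t(4) by simp
    then have "Fa \<alpha> \<in> L"
      using project[OF t(1)] t unfolding G(4)[symmetric] language_def
      by (auto simp: constants_def free_operad_def leaves_map_tree S_def[symmetric])
    ultimately show "\<alpha> \<in> {\<alpha> \<in> hom Q q0 qf. Fa \<alpha> \<in> L}" by simp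
  next
    fix \<alpha> assume "\<alpha> \<in> {\<alpha> \<in> hom Q q0 qf. Fa \<alpha> \<in> L}"
    then have \<alpha>: "\<alpha> \<in> arr Q" "src Q \<alpha> = q0" "tgt Q \<alpha> = qf" "Fa \<alpha> \<in> language G"
      using G(4) by (auto simp: hom_def)
    then obtain t where "t \<in> trees S" "leaves t = []" "root S t = start G" "?g t = [Fa \<alpha>]"
      by (auto simp: language_def constants_def free_operad_def S_def)
    from lift[OF this(1,2) \<alpha>(1) this(4)] this(3) \<alpha> show "\<alpha> \<in> language G'"
      by (auto simp: language_def G'_def constants_def free_operad_def)
  qed
  finally show ?thesis .
qed

end

section \<open>Closure under pullback along an automaton and under intersection with its
  language\<close>

theorem corollary4p3:
  fixes C :: "('o, 'a) cat" and Q :: "('q, 'b) cat" and A B :: 'o and L :: "'a set"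
    and M :: "('o, 'a, 'q, 'b) automaton"
  assumes "category C" and "finitely_generated C"
    and "context_free_language C A B L"
    and "nfa M" and "base M = C" and "states M = Q"
    and "aobj M (initial M) = A" and "aobj M (final M) = B"
  shows "context_free_language Q (initial M) (final M)
           {\<alpha> \<in> hom Q (initial M) (final M). aarr M \<alpha> \<in> L} \<and>
         context_free_language C A B (L \<inter> recognized M)"
proof -
  interpret finitary_ulf_functor Q C "aobj M" "aarr M"
    using assms(4-6) by (simp add: nfa_def finitary_ulf_functor_def)
  let ?L = "{\<alpha> \<in> hom Q (initial M) (final M). aarr M \<alpha> \<in> L}"
  have pullback: "context_free_language Q (initial M) (final M) ?L"
    using assms by (intro context_free_language_pullback) (auto simp: nfa_def)
  \<comment> \<open>A recognized word is the image of a run from the initial to the final state, and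
    that run belongs to the pullback exactly when the word belongs to \<open>L\<close>.\<close>
  have "L \<inter> recognized M = aarr M ` ?L"
    using assms(6) by (auto simp: recognized_def)
  with context_free_language_image[OF pullback assms(2)] assms(7,8) pullback
  show ?thesis by simp
qed

end
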